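(* For every integer $n\ge 1$, as formal power series in $x$, $$(c_2 c_3+c_3 c_1+c_1 c_2)^n (e^{\alpha x}+e^{\beta x}+ e^{\gamma x})=\left(\frac{-1}{22}\right)^n\sum_{k=0}^\infty T_k^{(3,1,3)}\frac{x^k}{k!}.$$
   Context: Let $\alpha,\beta,\gamma$ be the three distinct complex roots of $x^3-x^2-x-1=0$, and set $c_1=\frac{\alpha}{(\alpha-\beta)(\alpha-\gamma)}$, $c_2=\frac{\beta}{(\beta-\alpha)(\beta-\gamma)}$, $c_3=\frac{\gamma}{(\gamma-\alpha)(\gamma-\beta)}$. For numbers $s_0,s_1,s_2$, the sequence $T_k^{(s_0,s_1,s_2)}$ is defined by $T_0^{(s_0,s_1,s_2)}=s_0$, $T_1^{(s_0,s_1,s_2)}=s_1$, $T_2^{(s_0,s_1,s_2)}=s_2$ and $T_k^{(s_0,s_1,s_2)}=T_{k-1}^{(s_0,s_1,s_2)}+T_{k-2}^{(s_0,s_1,s_2)}+T_{k-3}^{(s_0,s_1,s_2)}$ for $k\ge3$. *)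

theory Defs
  imports Complex_Main "HOL-Computational_Algebra.Formal_Power_Series"
begin

fun tribonacci :: "'a::comm_ring_1 \<Rightarrow> 'a \<Rightarrow> 'a \<Rightarrow> nat \<Rightarrow> 'a" where
  "tribonacci s0 s1 s2 0 = s0"
| "tribonacci s0 s1 s2 (Suc 0) = s1"
| "tribonacci s0 s1 s2 (Suc (Suc 0)) = s2"
| "tribonacci s0 s1 s2 (Suc (Suc (Suc k))) =
     tribonacci s0 s1 s2 (Suc (Suc k)) + tribonacci s0 s1 s2 (Suc k) + tribonacci s0 s1 s2 k"

end

theory Submission
  imports Defs
begin

text \<open>
  With the elementary symmetric functions \<open>e1 = 1\<close>, \<open>e2 = -1\<close>, \<open>e3 = 1\<close> of the roots,
  the discriminant is \<open>D = -44\<close>. Over the common denominator \<open>D\<close> the sum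
  \<open>c2 c3 + c3 c1 + c1 c2\<close> has numerator \<open>e1 e3 - (e2\<^sup>2 - 2 e1 e3) = 2\<close>, so it equals
  \<open>-1/22\<close>. The power sums of the roots obey the tribonacci recurrence with initial values
  \<open>3, e1 = 1, e1\<^sup>2 - 2 e2 = 3\<close>.
\<close>

text \<open>The cubic need not be factored: cancelling nonzero differences of roots twice yields
  \<open>e1\<close>, and the other two relations follow by substitution.\<close>

lemma tribonacci_roots_vieta:
  fixes a b c :: "'a::field"
  assumes a: "a ^ 3 - a ^ 2 - a - 1 = 0" and b: "b ^ 3 - b ^ 2 - b - 1 = 0"
    and c: "c ^ 3 - c ^ 2 - c - 1 = 0"
    and distinct: "a \<noteq> b" "a \<noteq> c" "b \<noteq> c"
  shows "a + b + c = 1" "a * b + b * c + c * a = - 1" "a * b * c = 1"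
proof -
  have quotient: "x ^ 2 + x * y + y ^ 2 - (x + y) - 1 = 0"
    if "x ^ 3 - x ^ 2 - x - 1 = 0" "y ^ 3 - y ^ 2 - y - 1 = 0" "x \<noteq> y" for x y :: 'a
  proof -
    have "(x - y) * (x ^ 2 + x * y + y ^ 2 - (x + y) - 1)
        = (x ^ 3 - x ^ 2 - x - 1) - (y ^ 3 - y ^ 2 - y - 1)"
      by algebra
    with that show ?thesis by simp
  qed
  have ab: "a ^ 2 + a * b + b ^ 2 - (a + b) - 1 = 0"
    and ac: "a ^ 2 + a * c + c ^ 2 - (a + c) - 1 = 0"
    using quotient a b c distinct by blast+
  \<comment> \<open>This is \<open>ab\<close> minus \<open>ac\<close>.\<close>
  have "(b - c) * (a + b + c - 1) = 0"
    using ab ac by algebra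
  then show e1: "a + b + c = 1"
    using distinct by simp
  show e2: "a * b + b * c + c * a = - 1"
    using ab e1 by algebra
  show "a * b * c = 1"
    \<comment> \<open>Here b * c = - 1 - a * (1 - a), so a * b * c = a^3 - a^2 - a, which is 1 since
      a is a root.\<close>
    using a e1 e2 by algebra
qed

lemma tribonacci_discriminant:
  fixes a b c :: "'a::comm_ring_1"
  assumes "a + b + c = 1" "a * b + b * c + c * a = - 1" "a * b * c = 1"
  shows "((a - b) * (b - c) * (c - a)) ^ 2 = - 44"
proof -
  define s p q where "s = a + b + c" and "p = a * b + b * c + c * a" and "q = a * b * c"
  have "((a - b) * (b - c) * (c - a)) ^ 2
      = s ^ 2 * p ^ 2 - 4 * p ^ 3 - 4 * s ^ 3 * q + 18 * s * p * q - 27 * q ^ 2"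
    \<comment> \<open>The general cubic discriminant in elementary symmetric functions; here it is 1
      + 4 - 4 - 18 - 27.\<close>
    unfolding s_def p_def q_def by (simp add: algebra_simps power2_eq_square power3_eq_cube)
  also have "\<dots> = - 44"
    using assms by (simp add: s_def p_def q_def)
  finally show ?thesis .
qed

lemma tribonacci_power_sums:
  fixes a b c :: "'a::comm_ring_1"
  assumes a: "a ^ 3 - a ^ 2 - a - 1 = 0" and b: "b ^ 3 - b ^ 2 - b - 1 = 0"
    and c: "c ^ 3 - c ^ 2 - c - 1 = 0"
    and e1: "a + b + c = 1" and e2: "a * b + b * c + c * a = - 1"
  shows "tribonacci 3 1 3 k = a ^ k + b ^ k + c ^ k"
proof -
  have step: "x ^ Suc (Suc (Suc k)) = x ^ Suc (Suc k) + x ^ Suc k + x ^ k"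
    if "x ^ 3 - x ^ 2 - x - 1 = 0" for x :: 'a and k
  proof -
    have "x ^ Suc (Suc (Suc k)) - (x ^ Suc (Suc k) + x ^ Suc k + x ^ k)
        = x ^ k * (x ^ 3 - x ^ 2 - x - 1)"
      by (simp add: algebra_simps power2_eq_square power3_eq_cube)
    with that show ?thesis by simp
  qed
  have squares: "a ^ 2 + b ^ 2 + c ^ 2 = 3"
  proof -
    have "a ^ 2 + b ^ 2 + c ^ 2 = (a + b + c) ^ 2 - 2 * (a * b + b * c + c * a)"
      by (simp add: algebra_simps power2_eq_square)
    then show ?thesis using e1 e2 by simp
  qed
  show ?thesis
    \<comment> \<open>\<open>squares\<close> settles k = 2, once the exponent is in
      \<open>Suc\<close> form; keeping \<open>power_Suc\<close> out lets \<open>step\<close>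
      match.\<close>
    by (induction "3 :: 'a" "1 :: 'a" "3 :: 'a" k rule: tribonacci.induct)
      (use e1 squares in \<open>simp_all add: step [OF a] step [OF b] step [OF c] numeral_2_eq_2
        del: power_Suc\<close>)
qed

theorem theorem11:
  fixes \<alpha> \<beta> \<gamma> c1 c2 c3 :: complex and n :: nat
  assumes roots: "{x :: complex. x ^ 3 - x ^ 2 - x - 1 = 0} = {\<alpha>, \<beta>, \<gamma>}"
    and distinct: "\<alpha> \<noteq> \<beta>" "\<alpha> \<noteq> \<gamma>" "\<beta> \<noteq> \<gamma>"
    and c1: "c1 = \<alpha> / ((\<alpha> - \<beta>) * (\<alpha> - \<gamma>))"
    and c2: "c2 = \<beta> / ((\<beta> - \<alpha>) * (\<beta> - \<gamma>))"
    and c3: "c3 = \<gamma> / ((\<gamma> - \<alpha>) * (\<gamma> - \<beta>))"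
    and n: "n \<ge> 1"
  shows "fps_const ((c2 * c3 + c3 * c1 + c1 * c2) ^ n) * (fps_exp \<alpha> + fps_exp \<beta> + fps_exp \<gamma>) =
         fps_const ((- 1 / 22) ^ n) * Abs_fps (\<lambda>k. tribonacci 3 1 3 k / fact k)"
proof -
  have root: "\<alpha> ^ 3 - \<alpha> ^ 2 - \<alpha> - 1 = 0" "\<beta> ^ 3 - \<beta> ^ 2 - \<beta> - 1 = 0"
    "\<gamma> ^ 3 - \<gamma> ^ 2 - \<gamma> - 1 = 0"
    using roots by blast+
  note vieta = tribonacci_roots_vieta [OF root distinct]
  define D where "D = ((\<alpha> - \<beta>) * (\<beta> - \<gamma>) * (\<gamma> - \<alpha>)) ^ 2"
  have D: "D = - 44"
    unfolding D_def using vieta by (rule tribonacci_discriminant)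
  define u v w where "u = \<alpha> - \<beta>" and "v = \<beta> - \<gamma>" and "w = \<gamma> - \<alpha>"
  have Duvw: "D = (u * v * w) ^ 2"
    by (simp add: D_def u_def v_def w_def)
  have "c1 * (u * w) = - \<alpha>" "c2 * (u * v) = - \<beta>" "c3 * (w * v) = - \<gamma>"
    unfolding c1 c2 c3 u_def v_def w_def using distinct by (simp_all add: divide_simps) (simp_all add: algebra_simps)
  \<comment> \<open>The signs cancel in pairs. Each product of two coefficients has denominator u *
    v * w times one further difference, so multiplying by \<open>D\<close> leaves the other two
    differences.\<close>
  then have "(c2 * c3 + c3 * c1 + c1 * c2) * D
      = \<beta> * \<gamma> * (u * w) + \<gamma> * \<alpha> * (u * v) + \<alpha> * \<beta> * (v * w)"
    unfolding Duvw by algebra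
  \<comment> \<open>The first summand is \<alpha>\<beta>\<gamma> (\<beta> + \<gamma> - \<alpha>) -
    (\<beta>\<gamma>)^2, and the others follow cyclically.\<close>
  also have "\<dots> = 2"
    using vieta unfolding u_def v_def w_def by algebra
  finally have "c2 * c3 + c3 * c1 + c1 * c2 = 2 / D"
    by (subst eq_divide_eq) (simp add: D)
  then have c: "c2 * c3 + c3 * c1 + c1 * c2 = - 1 / 22"
    by (simp add: D)
  have "fps_exp \<alpha> + fps_exp \<beta> + fps_exp \<gamma> = Abs_fps (\<lambda>k. tribonacci 3 1 3 k / fact k)"
    by (rule fps_ext) (simp add: tribonacci_power_sums [OF root vieta(1,2)] add_divide_distrib)
  then show ?thesis
    unfolding c by simp
qed

end
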